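(* Let $\mathbb{F}$ be a field of characteristic zero and let $\psi$ be the $\mathbb{F}$-linear functional on $\mathbb{F}[\alpha_1,\alpha_2]$ defined on monomials by $\psi(\alpha_1^{2m}\alpha_2^{2n})=\Omega(m,n)1_{\mathbb{F}}$ for $m,n\in\mathbb{N}$ and $\psi(\alpha_1^k\alpha_2^l)=0$ if $k$ or $l$ is odd. Then $\psi$ satisfies Locality: if $\pi\in\mathbb{F}[\alpha_1,\alpha_2]$ satisfies $\pi(x,y)=0$ for all $[x,y]\in\mathbb{F}^2$ with $x^2+y^2=1$, then $\psi(\pi)=0$.
   Context: $\mathbb{N}$ includes $0$. $\Omega(m,n)=\dfrac{(2m)!(2n)!}{4^{m+n}\,m!\,n!\,(m+n)!}\in\mathbb{Q}$, and $a1_{\mathbb{F}}$ is the image of $a\in\mathbb{Q}$ in $\mathbb{F}$. *)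

theory Defs
  imports Complex_Main "HOL-Computational_Algebra.Polynomial"
begin

definition Omega :: "nat \<Rightarrow> nat \<Rightarrow> rat" where
  "Omega m n = (fact (2 * m) * fact (2 * n)) / (4 ^ (m + n) * fact m * fact n * fact (m + n))"

(* The ring F[alpha1, alpha2] is rendered as F[alpha1][alpha2]: the inner
   polynomial variable is alpha1, the outer one is alpha2. *)
type_synonym 'a poly2 = "'a poly poly"

definition alpha1 :: "'a::comm_semiring_1 poly2" where
  "alpha1 = [:[:0, 1:]:]"

definition alpha2 :: "'a::comm_semiring_1 poly2" where
  "alpha2 = [:0, 1:]"

definition scale2 :: "'a::comm_semiring_0 \<Rightarrow> 'a poly2 \<Rightarrow> 'a poly2" where
  "scale2 c p = smult [:c:] p"

definition eval2 :: "'a::comm_semiring_0 poly2 \<Rightarrow> 'a \<Rightarrow> 'a \<Rightarrow> 'a" where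
  "eval2 p x y = poly (poly p [:y:]) x"

definition linear_functional :: "('a::field poly2 \<Rightarrow> 'a) \<Rightarrow> bool" where
  "linear_functional \<psi> \<longleftrightarrow> Vector_Spaces.linear scale2 (*) \<psi>"

definition locality :: "('a::field poly2 \<Rightarrow> 'a) \<Rightarrow> bool" where
  "locality \<psi> \<longleftrightarrow>
     (\<forall>\<pi>. (\<forall>x y. x\<^sup>2 + y\<^sup>2 = 1 \<longrightarrow> eval2 \<pi> x y = 0) \<longrightarrow> \<psi> \<pi> = 0)"

lemma eval2_simps [simp]:
  fixes x y :: "'a::comm_ring_1"
  shows "eval2 alpha1 x y = x" "eval2 alpha2 x y = y"
    "eval2 (p + q) x y = eval2 p x y + eval2 q x y"
    "eval2 (p * q) x y = eval2 p x y * eval2 q x y"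
    "eval2 (p ^ n) x y = eval2 p x y ^ n"
    "eval2 (scale2 c p) x y = c * eval2 p x y"
  by (simp_all add: eval2_def alpha1_def alpha2_def scale2_def)

lemma alpha_monom:
  "alpha1 ^ k * alpha2 ^ l = monom (monom (1::'a::comm_ring_1) k) l"
proof -
  have 1: "alpha1 ^ k = ([:monom 1 k:] :: 'a poly2)"
    by (induction k) (simp_all add: alpha1_def monom_Suc)
  have 2: "alpha2 ^ l = (monom 1 l :: 'a poly2)"
    by (induction l) (simp_all add: alpha2_def monom_Suc)
  show ?thesis by (simp add: 1 2 smult_monom)
qed

lemma poly2_expansion:
  fixes p :: "'a::comm_ring_1 poly2"
  shows "p = (\<Sum>l\<le>degree p. \<Sum>k\<le>degree (coeff p l).
               scale2 (coeff (coeff p l) k) (alpha1 ^ k * alpha2 ^ l))"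
proof -
  have inner: "(\<Sum>k\<le>degree q. scale2 (coeff q k) (alpha1 ^ k * alpha2 ^ l)) = monom q l"
    for q :: "'a poly" and l
  proof -
    have "(\<Sum>k\<le>degree q. scale2 (coeff q k) (alpha1 ^ k * alpha2 ^ l))
        = (\<Sum>k\<le>degree q. monom (monom (coeff q k) k) l)"
      by (simp add: alpha_monom scale2_def smult_monom)
    also have "\<dots> = monom (\<Sum>k\<le>degree q. monom (coeff q k) k) l"
      by (rule poly_eqI) (simp add: coeff_sum)
    finally show ?thesis by (simp add: poly_as_sum_of_monoms)
  qed
  show ?thesis by (simp add: inner poly_as_sum_of_monoms)
qed

lemma vector_space_scale2: "vector_space (scale2 :: 'a::field \<Rightarrow> 'a poly2 \<Rightarrow> 'a poly2)"
proof
  fix a b :: 'a and p q :: "'a poly2"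
  show "scale2 a (p + q) = scale2 a p + scale2 a q"
    by (simp add: scale2_def smult_add_right)
  show "scale2 (a + b) p = scale2 a p + scale2 b p"
    unfolding scale2_def by (subst smult_add_left [symmetric]) simp
  show "scale2 a (scale2 b p) = scale2 (a * b) p"
    by (simp add: scale2_def mult.commute)
  show "scale2 1 p = p"
    by (simp add: scale2_def flip: one_pCons)
qed

lemma linear_functional_iff:
  "linear_functional \<psi> \<longleftrightarrow>
     (\<forall>p q. \<psi> (p + q) = \<psi> p + \<psi> q) \<and> (\<forall>a p. \<psi> (scale2 a p) = a * \<psi> p)"
proof -
  have "vector_space ((*) :: 'a::field \<Rightarrow> 'a \<Rightarrow> 'a)"
    by standard (simp_all add: algebra_simps)
  with vector_space_scale2 show ?thesis
    unfolding linear_functional_def Vector_Spaces.linear_def module_hom_def module_hom_axioms_def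
    by (auto simp: vector_space_def module_def)
qed

lemma linear_functional_sum:
  assumes "linear_functional \<psi>"
  shows "\<psi> (\<Sum>i\<in>A. f i) = (\<Sum>i\<in>A. \<psi> (f i))"
proof -
  have "module_hom scale2 (*) \<psi>"
    using assms unfolding linear_functional_def Vector_Spaces.linear_def by blast
  then show ?thesis by (rule module_hom.sum)
qed

(* A linear functional on F[alpha1, alpha2] is determined by arbitrary values on the monomials. *)
lemma ex1_linear_functional:
  fixes c :: "nat \<Rightarrow> nat \<Rightarrow> 'a::field"
  shows "\<exists>!\<psi>. linear_functional \<psi> \<and> (\<forall>k l. \<psi> (alpha1 ^ k * alpha2 ^ l) = c k l)"
proof (rule ex_ex1I)
  define in1 where "in1 N l q = (\<Sum>k\<le>N. coeff q k * c k l)" for N l :: nat and q :: "'a poly"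
  define g where "g l q = in1 (degree q) l q" for l q
  define \<psi> where "\<psi> p = (\<Sum>l\<le>degree p. g l (coeff p l))" for p :: "'a poly2"
  have g: "g l q = in1 N l q" if "degree q \<le> N" for N l q
    unfolding g_def in1_def by (rule sum.mono_neutral_left) (use that in \<open>auto simp: coeff_eq_0\<close>)
  have g_add: "g l (q + r) = g l q + g l r" for l q r
  proof -
    define N where "N = max (degree q) (degree r)"
    have "degree (q + r) \<le> N" "degree q \<le> N" "degree r \<le> N"
      by (auto simp: N_def degree_add_le_max)
    then show ?thesis by (simp add: g[of _ N] in1_def sum.distrib algebra_simps)
  qed
  have g_smult: "g l (smult a q) = a * g l q" for l a q
    by (simp add: g[of _ "degree q"] degree_smult_le in1_def sum_distrib_left mult.assoc)
  have g0 [simp]: "g l 0 = 0" for l by (simp add: g_def in1_def)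
  have psi: "\<psi> p = (\<Sum>l\<le>N. g l (coeff p l))" if "degree p \<le> N" for N p
    unfolding \<psi>_def by (rule sum.mono_neutral_left) (use that in \<open>auto simp: coeff_eq_0\<close>)
  have "\<psi> (p + q) = \<psi> p + \<psi> q" for p q
  proof -
    define N where "N = max (degree p) (degree q)"
    have "degree (p + q) \<le> N" "degree p \<le> N" "degree q \<le> N"
      by (auto simp: N_def degree_add_le_max)
    then show ?thesis by (simp add: psi[of _ N] g_add sum.distrib)
  qed
  moreover have "\<psi> (scale2 a p) = a * \<psi> p" for a p
    by (simp add: psi[of _ "degree p"] degree_smult_le scale2_def g_smult sum_distrib_left)
  moreover have "\<psi> (alpha1 ^ k * alpha2 ^ l) = c k l" for k l
  proof -
    have "\<psi> (monom (monom 1 k) l) = (\<Sum>i\<le>l. if i = l then g i (monom 1 k) else 0)"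
      unfolding psi[of "monom (monom 1 k) l" l, OF degree_monom_le] by (intro sum.cong) auto
    also have "\<dots> = in1 k l (monom 1 k)"
      by (simp add: g[of _ k] degree_monom_le)
    also have "\<dots> = (\<Sum>i\<le>k. if i = k then c i l else 0)"
      unfolding in1_def by (intro sum.cong) auto
    finally show ?thesis by (simp add: alpha_monom)
  qed
  ultimately show "\<exists>\<psi>. linear_functional \<psi> \<and> (\<forall>k l. \<psi> (alpha1 ^ k * alpha2 ^ l) = c k l)"
    by (auto simp: linear_functional_iff)
next
  fix \<phi> \<psi> :: "'a poly2 \<Rightarrow> 'a"
  assume 1: "linear_functional \<phi> \<and> (\<forall>k l. \<phi> (alpha1 ^ k * alpha2 ^ l) = c k l)"
    and 2: "linear_functional \<psi> \<and> (\<forall>k l. \<psi> (alpha1 ^ k * alpha2 ^ l) = c k l)"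
  have *: "\<chi> p = (\<Sum>l\<le>degree p. \<Sum>k\<le>degree (coeff p l). coeff (coeff p l) k * c k l)"
    if "linear_functional \<chi> \<and> (\<forall>k l. \<chi> (alpha1 ^ k * alpha2 ^ l) = c k l)" for \<chi> p
  proof -
    have "linear_functional \<chi>" using that by blast
    then show ?thesis
      by (subst poly2_expansion[of p])
        (use that in \<open>simp add: linear_functional_sum linear_functional_iff\<close>)
  qed
  show "\<phi> = \<psi>" using *[OF 1] *[OF 2] by auto
qed

end

(* Division by the monic polynomial alpha2^2 + (alpha1^2 - 1) leaves a remainder a + b * alpha2
   with a, b in F[alpha1]. If pi vanishes on the circle, the points (x, y) and (x, -y) give
   a(x) = b(x) = 0 for infinitely many x, so pi is a multiple of alpha1^2 + alpha2^2 - 1, and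
   psi kills such multiples because Omega(m + 1, n) + Omega(m, n + 1) = Omega(m, n). *)
theory Submission imports Defs begin

text \<open>Since \<open>fact (2 * Suc m)\<close> is \<open>2 * M * K * fact (2 * m)\<close>, the
  factor \<open>M\<close> cancels against \<open>fact (Suc m)\<close>, and the new factors
  \<open>2 * K\<close> over \<open>4 * S\<close> give the ratio.\<close>

lemma Omega_Suc_left:
  "Omega (Suc m) n = Omega m n * (2 * of_nat m + 1) / (2 * (of_nat m + of_nat n + 1))"
proof -
  define M K S :: rat where "M = of_nat m + 1" and "K = 2 * of_nat m + 1"
    and "S = of_nat m + of_nat n + 1"
  have "M = of_nat (Suc m)" "S = of_nat (Suc (m + n))" by (simp_all add: M_def S_def)
  then have nz: "M \<noteq> 0" "S \<noteq> 0" by (simp_all only: of_nat_neq_0 not_False_eq_True)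
  have facts: "fact (2 * Suc m) = 2 * M * K * fact (2 * m)" "fact (Suc m) = M * fact m"
      "fact (Suc m + n) = S * fact (m + n)" "(4 :: rat) ^ (Suc m + n) = 4 * 4 ^ (m + n)"
    by (simp_all add: M_def K_def S_def algebra_simps)
  show ?thesis
    unfolding Omega_def facts K_def [symmetric] S_def [symmetric]
    using nz by (simp add: divide_simps)
qed

lemma Omega_commute: "Omega m n = Omega n m"
  by (simp add: Omega_def ac_simps)

text \<open>The ratios for raising either index share a denominator, and their numerators
  \<open>2 * m + 1\<close> and \<open>2 * n + 1\<close> add up to it.\<close>

lemma Omega_Suc_add: "Omega (Suc m) n + Omega m (Suc n) = Omega m n"
proof -
  have "(of_nat m + of_nat n + 1 :: rat) = of_nat (Suc (m + n))" by simp
  then have nz: "of_nat m + of_nat n + 1 \<noteq> (0 :: rat)" by (simp only: of_nat_neq_0 not_False_eq_True)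
  have "Omega m (Suc n) = Omega m n * (2 * of_nat n + 1) / (2 * (of_nat m + of_nat n + 1))"
    using Omega_Suc_left [of n m]
    by (simp add: Omega_commute [of m "Suc n"] Omega_commute [of m n] add.commute)
  then have "Omega (Suc m) n + Omega m (Suc n)
      = (Omega m n * (2 * of_nat m + 1) + Omega m n * (2 * of_nat n + 1)) / (2 * (of_nat m + of_nat n + 1))"
    by (simp only: Omega_Suc_left add_divide_distrib)
  also have "Omega m n * (2 * of_nat m + 1) + Omega m n * (2 * of_nat n + 1)
      = Omega m n * (2 * (of_nat m + of_nat n + 1))"
    by (simp add: algebra_simps)
  finally show ?thesis using nz by simp
qed

text \<open>The rational parametrization ((1 - t^2) / (1 + t^2), 2t / (1 + t^2)) at natural t
  already yields infinitely many abscissae. The condition \<open>y \<noteq> 0\<close> is what later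
  separates (x, y) from its mirror image (x, -y).\<close>

lemma infinite_circle_abscissae:
  "infinite {x :: 'a::field_char_0. \<exists>y. y \<noteq> 0 \<and> x\<^sup>2 + y\<^sup>2 = 1}"
proof -
  define f :: "nat \<Rightarrow> 'a" where "f n = (1 - (of_nat n)\<^sup>2) / (1 + (of_nat n)\<^sup>2)" for n
  have nz: "1 + (of_nat n)\<^sup>2 \<noteq> (0 :: 'a)" for n
    using of_nat_neq_0 [of "n\<^sup>2", where 'a = 'a] by simp
  have "m = n" if "f m = f n" for m n
  proof -
    have "(1 - (of_nat m)\<^sup>2) * (1 + (of_nat n)\<^sup>2) = ((1 - (of_nat n)\<^sup>2) * (1 + (of_nat m)\<^sup>2) :: 'a)"
      using that nz by (simp add: f_def frac_eq_eq)
    then have "2 * (of_nat m)\<^sup>2 = (2 * (of_nat n)\<^sup>2 :: 'a)"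
      by (simp add: algebra_simps)
    \<comment> \<open>Characteristic zero takes the equation back to the naturals, where squaring is
      injective.\<close>
    then have "of_nat (m\<^sup>2) = (of_nat (n\<^sup>2) :: 'a)" by simp
    then have "m\<^sup>2 = n\<^sup>2" by (simp only: of_nat_eq_iff)
    then show ?thesis by simp
  qed
  \<comment> \<open>The parameter 0 is left out because it gives the point (1, 0), whose ordinate
    vanishes.\<close>
  then have "inj_on f {1..}" by (auto intro: inj_onI)
  then have "infinite (f ` {1..})"
    by (simp add: finite_image_iff infinite_Ici)
  moreover have "f ` {1..} \<subseteq> {x. \<exists>y. y \<noteq> 0 \<and> x\<^sup>2 + y\<^sup>2 = 1}"
  proof (intro image_subsetI CollectI)
    fix n :: nat assume "n \<in> {1..}"
    define y :: 'a where "y = 2 * of_nat n / (1 + (of_nat n)\<^sup>2)"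
    have "y \<noteq> 0" using \<open>n \<in> {1..}\<close> nz by (simp add: y_def)
    moreover have "(f n)\<^sup>2 + y\<^sup>2 = ((1 - (of_nat n)\<^sup>2)\<^sup>2 + (2 * of_nat n)\<^sup>2) / (1 + (of_nat n)\<^sup>2)\<^sup>2"
      by (simp add: f_def y_def power_divide add_divide_distrib)
    moreover have "(1 - (of_nat n)\<^sup>2)\<^sup>2 + (2 * of_nat n)\<^sup>2 = ((1 + (of_nat n)\<^sup>2)\<^sup>2 :: 'a)"
      by (simp add: power2_eq_square algebra_simps)
    ultimately show "\<exists>y. y \<noteq> 0 \<and> (f n)\<^sup>2 + y\<^sup>2 = 1"
      using nz [of n] by auto
  qed
  ultimately show ?thesis using infinite_super by blast
qed

lemma vanishing_on_circle_imp_dvd: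
  fixes p :: "'a::field_char_0 poly2"
  assumes "\<And>x y. x\<^sup>2 + y\<^sup>2 = 1 \<Longrightarrow> eval2 p x y = 0"
  shows "alpha1\<^sup>2 + alpha2\<^sup>2 - 1 dvd p"
proof -
  define d :: "'a poly2" where "d = [:[:-1, 0, 1:], 0, 1:]"
  have d: "d = alpha1\<^sup>2 + alpha2\<^sup>2 - 1"
    by (simp add: d_def alpha1_def alpha2_def power2_eq_square one_pCons)
  \<comment> \<open>The coefficients form the ring F[alpha1], not a field, hence pseudo-division; as
    \<open>d\<close> is monic in \<open>alpha2\<close>, the scaling factor it puts on
    \<open>p\<close> is 1.\<close>
  obtain q r where qr: "pseudo_divmod p d = (q, r)" by fastforce
  have "d \<noteq> 0" "degree d = 2" "lead_coeff d = 1" by (simp_all add: d_def)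
  with pseudo_divmod [OF _ qr] have p: "p = d * q + r" and deg: "degree r < 2"
    by auto
  obtain a b where r: "r = [:a, b:]"
  proof
    show "r = [:coeff r 0, coeff r 1:]"
      using deg by (auto intro!: poly_eqI simp: coeff_pCons coeff_eq_0 split: nat.split)
  qed
  have zero: "poly a x + y * poly b x = 0" if "x\<^sup>2 + y\<^sup>2 = 1" for x y
  proof -
    have "eval2 d x y = 0"
      using that by (simp add: d_def eval2_def power2_eq_square algebra_simps)
    then show ?thesis
      using assms [OF that] by (simp add: p) (simp add: r eval2_def)
  qed
  have roots: "poly a x = 0 \<and> poly b x = 0" if "y \<noteq> 0" "x\<^sup>2 + y\<^sup>2 = 1" for x y
  proof -
    have plus: "poly a x + y * poly b x = 0" and minus: "poly a x - y * poly b x = 0"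
      using zero [of x y] zero [of x "- y"] that by simp_all
    \<comment> \<open>In characteristic zero the 2 cancels; \<open>plus\<close> then leaves
      \<open>y * poly b x = 0\<close> with \<open>y\<close> nonzero.\<close>
    have "2 * poly a x = 0" using plus minus by algebra
    then show ?thesis using plus \<open>y \<noteq> 0\<close> by simp
  qed
  let ?S = "{x :: 'a. \<exists>y. y \<noteq> 0 \<and> x\<^sup>2 + y\<^sup>2 = 1}"
  have "c = 0" if "\<And>x. x \<in> ?S \<Longrightarrow> poly c x = 0" for c
  proof (rule ccontr)
    assume "c \<noteq> 0"
    then have "finite {x. poly c x = 0}" by (rule poly_roots_finite)
    moreover have "?S \<subseteq> {x. poly c x = 0}" using that by blast
    ultimately show False using infinite_circle_abscissae finite_subset by blast
  qed
  then have "a = 0" "b = 0" using roots by blast+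
  then show ?thesis by (simp add: p r d)
qed

text \<open>Expanding \<open>q\<close> into monomials makes \<open>q * d\<close> a linear
  combination of monomial multiples of \<open>d\<close>, so checking those is enough.\<close>

lemma linear_functional_eq_0_on_multiples:
  fixes \<psi> :: "'a::field poly2 \<Rightarrow> 'a"
  assumes lin: "linear_functional \<psi>"
    and zero: "\<And>k l. \<psi> (alpha1 ^ k * alpha2 ^ l * d) = 0"
  shows "\<psi> (q * d) = 0"
proof -
  have scale: "scale2 c p * d = scale2 c (p * d)" for c p
    by (simp add: scale2_def)
  have "q * d = (\<Sum>l\<le>degree q. \<Sum>k\<le>degree (coeff q l).
      scale2 (coeff (coeff q l) k) (alpha1 ^ k * alpha2 ^ l * d))"
    by (subst poly2_expansion [of q]) (simp add: sum_distrib_right scale)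
  then show ?thesis
    using lin zero by (simp add: linear_functional_sum) (simp add: linear_functional_iff)
qed

theorem theorem8:
  fixes \<psi> :: "'a::field_char_0 poly2 \<Rightarrow> 'a"
  assumes "linear_functional \<psi>"
    and "\<And>m n. \<psi> (alpha1 ^ (2 * m) * alpha2 ^ (2 * n)) = of_rat (Omega m n)"
    and "\<And>k l. odd k \<or> odd l \<Longrightarrow> \<psi> (alpha1 ^ k * alpha2 ^ l) = 0"
  shows "locality \<psi>"
  unfolding locality_def
proof (intro allI impI)
  fix p :: "'a poly2"
  assume "\<forall>x y. x\<^sup>2 + y\<^sup>2 = 1 \<longrightarrow> eval2 p x y = 0"
  then obtain q where q: "p = q * (alpha1\<^sup>2 + alpha2\<^sup>2 - 1)"
    using vanishing_on_circle_imp_dvd [of p] by (auto elim!: dvdE simp: mult.commute [of _ "alpha1\<^sup>2 + alpha2\<^sup>2 - 1"])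
  have add: "\<psi> (p + q) = \<psi> p + \<psi> q" for p q
    using assms(1) by (simp add: linear_functional_iff)
  have diff: "\<psi> (p - q) = \<psi> p - \<psi> q" for p q
    using add [of "p - q" q] by simp
  have "\<psi> (alpha1 ^ k * alpha2 ^ l * (alpha1\<^sup>2 + alpha2\<^sup>2 - 1)) = 0" for k l
  proof -
    have "alpha1 ^ k * alpha2 ^ l * (alpha1\<^sup>2 + alpha2\<^sup>2 - 1)
        = alpha1 ^ (k + 2) * alpha2 ^ l + alpha1 ^ k * alpha2 ^ (l + 2)
          - (alpha1 ^ k * alpha2 ^ l :: 'a poly2)"
      by (simp add: power_add power2_eq_square algebra_simps)
    then have eq: "\<psi> (alpha1 ^ k * alpha2 ^ l * (alpha1\<^sup>2 + alpha2\<^sup>2 - 1))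
        = \<psi> (alpha1 ^ (k + 2) * alpha2 ^ l) + \<psi> (alpha1 ^ k * alpha2 ^ (l + 2))
          - \<psi> (alpha1 ^ k * alpha2 ^ l)"
      by (simp only: add diff)
    show ?thesis
    \<comment> \<open>The exponents in the three terms of \<open>eq\<close> differ by 0 or 2, so all
      three share the parities of \<open>k\<close> and \<open>l\<close>: either every term is zero,
      or the recurrence for \<open>Omega\<close> cancels them.\<close>
    proof (cases "odd k \<or> odd l")
      case True
      then show ?thesis
        unfolding eq using assms(3) [of "k + 2" l] assms(3) [of k "l + 2"] assms(3) [of k l] by auto
    next
      case False
      then obtain m n where "k = 2 * m" "l = 2 * n" by (auto elim!: evenE)
      then have "\<psi> (alpha1 ^ k * alpha2 ^ l * (alpha1\<^sup>2 + alpha2\<^sup>2 - 1))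
          = of_rat (Omega (Suc m) n) + of_rat (Omega m (Suc n)) - of_rat (Omega m n)"
        unfolding eq using assms(2) [of "Suc m" n] assms(2) [of m "Suc n"] assms(2) [of m n] by simp
      then show ?thesis by (simp add: Omega_Suc_add flip: of_rat_add)
    qed
  qed
  then show "\<psi> p = 0"
    unfolding q by (rule linear_functional_eq_0_on_multiples [OF assms(1)])
qed

end
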